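(* Let $x$ and $k$ be indeterminates and let $A_n^{(k)}(x)$, $n\ge 0$, be the $1/k$-Eulerian polynomials. Let $h_n=\det\bigl(A_{i+j}^{(k)}(x)\bigr)_{0\le i,j\le n}$ be their Hankel transform. Then for all $n\ge 0$ $$h_n=(kx)^{\binom{n+1}{2}}\left(\prod_{j=0}^n j!\right)\prod_{i=1}^n(ik+1)^{n-i}=(kx)^{\binom{n+1}{2}}\prod_{i=1}^n i!\,(ik+1)^{n-i}.$$
   Context: The Savage-Viswanathan polynomials $F_n(x,y)$ are defined by the exponential generating function $\sum_{n\ge 0}F_n(x,y)\frac{z^n}{n!}=\left(\frac{1-x}{e^{z(x-1)}-x}\right)^y$ (a formal power series in $z$; the base has constant term $1$, and $u^y=\exp(y\ln u)$). They are polynomials in $x,y$. The $1/k$-Eulerian polynomials are $A_n^{(k)}(x)=k^nF_n(x,1/k)$. *)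

theory Defs
  imports
    "HOL-Computational_Algebra.Computational_Algebra"
    "Jordan_Normal_Form.Determinant"
begin

instance fract :: ("{idom, ring_char_0}") field_char_0
proof
  show "inj (of_nat :: nat \<Rightarrow> 'a fract)"
    by (rule injI) (simp add: of_nat_fract eq_fract)
qed

text \<open>
  The power \<open>u\<^sup>y = exp (y ln u)\<close> of a formal power series \<open>u\<close> with constant term 1:
  \<open>fps_ln 1\<close> is the series of \<open>ln (1 + X)\<close> and \<open>fps_exp y\<close> that of \<open>exp (y X)\<close>.
\<close>
definition fps_pow :: "'a::field_char_0 fps \<Rightarrow> 'a \<Rightarrow> 'a fps" where
  "fps_pow u y = fps_exp y oo (fps_ln 1 oo (u - 1))"

text \<open>The base has constant term 1 for \<open>x \<noteq> 1\<close> only; \<open>x = 1\<close> gives junk values.\<close>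
definition sv_base :: "'a::field_char_0 \<Rightarrow> 'a fps" where
  "sv_base x = fps_const (1 - x) / (fps_exp (x - 1) - fps_const x)"

definition sv_poly :: "nat \<Rightarrow> 'a::field_char_0 \<Rightarrow> 'a \<Rightarrow> 'a" where
  "sv_poly n x y = fact n * fps_nth (fps_pow (sv_base x) y) n"

definition inv_eulerian :: "nat \<Rightarrow> 'a::field_char_0 \<Rightarrow> 'a \<Rightarrow> 'a" where
  "inv_eulerian n k x = k ^ n * sv_poly n x (1 / k)"

definition hankel_transform :: "(nat \<Rightarrow> 'a::comm_ring_1) \<Rightarrow> nat \<Rightarrow> 'a" where
  "hankel_transform a n = det (mat (n + 1) (n + 1) (\<lambda>(i, j). a (i + j)))"

text \<open>
  The two indeterminates, as elements of the fraction field of \<open>\<rat>[x][k]\<close>,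
  in which \<open>1 / k\<close> and \<open>1 / (1 - x)\<close> exist.
\<close>
definition indet_x :: "rat poly poly fract" where
  "indet_x = to_fract [:[:0, 1:]:]"

definition indet_k :: "rat poly poly fract" where
  "indet_k = to_fract [:0, 1:]"

lemma indet_x_neq_1: "indet_x \<noteq> 1"
  by (simp add: indet_x_def One_fract_def to_fract_def eq_fract one_pCons)

lemma indet_k_neq_0: "indet_k \<noteq> 0"
  by (simp add: indet_k_def)

lemma sv_base_nth_0: "x \<noteq> 1 \<Longrightarrow> fps_nth (sv_base x) 0 = 1"
  by (simp add: sv_base_def fps_divide_unit)

lemma sv_poly_egf: "Abs_fps (\<lambda>n. sv_poly n x y / fact n) = fps_pow (sv_base x) y"
  by (simp add: sv_poly_def fps_eq_iff)

end

theory Submission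
  imports Defs
begin

text \<open>
  Let \<open>u\<close> be the base of the generating function and \<open>f = u\<^sup>y\<close>. They satisfy
  \<open>u' = u (1 - x + x u)\<close> and \<open>f' = y f (1 - x + x u)\<close>. Hence differentiating \<open>f (u - 1)\<^sup>m\<close> gives a
  combination of \<open>f (u - 1)\<^sup>l\<close> with \<open>\<bar>l - m\<bar> \<le> 1\<close>, and the suitably scaled Taylor coefficients of
  these series, with \<open>y = 1 / k\<close>, form a Stieltjes array: a lower unitriangular array whose rows
  arise from one another by a tridiagonal matrix, here with off-diagonal products
  \<open>k x (m + 1) (m k + 1)\<close>. Its first column consists of the \<open>1/k\<close>-Eulerian polynomials. As the
  tridiagonal matrix is symmetric for a suitable diagonal form, the Hankel matrix of the first
  column factors as \<open>L D L\<^sup>T\<close>.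
\<close>

subsection \<open>Stieltjes arrays\<close>

locale stieltjes_array =
  fixes L :: "nat \<Rightarrow> nat \<Rightarrow> 'a::comm_ring_1" and b l :: "nat \<Rightarrow> 'a"
  assumes row_0: "L 0 m = (if m = 0 then 1 else 0)"
    and Suc_0: "L (Suc n) 0 = b 0 * L n 0 + l 0 * L n 1"
    and Suc_Suc: "L (Suc n) (Suc m) =
      L n m + b (Suc m) * L n (Suc m) + l (Suc m) * L n (Suc (Suc m))"
begin

lemma eq_0: "n < m \<Longrightarrow> L n m = 0"
proof (induction n arbitrary: m)
  case 0
  then show ?case by (simp add: row_0)
next
  case (Suc n)
  then show ?case by (cases m) (auto simp: Suc_Suc)
qed

lemma diagonal: "L n n = 1"
  by (induction n) (simp_all add: row_0 Suc_Suc eq_0)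

text \<open>The recursion \<open>weight (Suc m) = weight m * l m\<close> is what symmetrises the
  tridiagonal matrix, whose entries off the diagonal are 1 and \<open>l m\<close>.\<close>

definition weight :: "nat \<Rightarrow> 'a" where
  "weight m = (\<Prod>i<m. l i)"

text \<open>The \<open>b\<close> terms cancel and the rest telescopes; by symmetry only the boundary
  term of the truncation survives.\<close>

lemma christoffel_darboux:
  "(\<Sum>m<Suc N. weight m * (L (Suc i) m * L j m - L i m * L (Suc j) m)) =
     weight (Suc N) * (L i (Suc N) * L j N - L i N * L j (Suc N))"
proof (induction N)
  case 0
  then show ?case by (simp add: weight_def Suc_0 algebra_simps)
next
  case (Suc N)
  have "weight (Suc (Suc N)) = weight (Suc N) * l (Suc N)"
    by (simp add: weight_def)
  then show ?case
    unfolding sum.lessThan_Suc[of _ "Suc N"] Suc.IH by (simp add: Suc_Suc algebra_simps)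
qed

text \<open>Units are moved from the first row index to the second until row 0, a unit vector, is
  left: as \<open>N\<close> exceeds both indices, the boundary term vanishes.\<close>

lemma first_column_add:
  "i + j < N \<Longrightarrow> (\<Sum>m<N. weight m * (L i m * L j m)) = L (i + j) 0"
proof (induction i arbitrary: j)
  case 0
  then have "(\<Sum>m<N. weight m * (L 0 m * L j m)) = (\<Sum>m<N. if m = 0 then L j 0 else 0)"
    by (intro sum.cong) (auto simp: row_0 weight_def)
  with 0 show ?case by simp
next
  case (Suc i)
  then obtain M where N: "N = Suc M" by (cases N) auto
  have "(\<Sum>m<N. weight m * (L (Suc i) m * L j m - L i m * L (Suc j) m)) = 0"
    unfolding N christoffel_darboux using Suc.prems by (simp add: N eq_0)
  then have "(\<Sum>m<N. weight m * (L (Suc i) m * L j m)) = (\<Sum>m<N. weight m * (L i m * L (Suc j) m))"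
    by (simp add: right_diff_distrib sum_subtractf)
  also have "\<dots> = L (i + Suc j) 0"
    using Suc.prems by (intro Suc.IH) simp
  finally show ?case by simp
qed

lemma hankel_transform_first_column:
  "hankel_transform (\<lambda>m. L m 0) n = (\<Prod>m\<le>n. \<Prod>i<m. l i)"
proof -
  define A where "A = mat (n + 1) (n + 1) (\<lambda>(i, m). L i m)"
  \<comment> \<open>\<open>B\<close> is D L^T: with all weights in this factor, \<open>A\<close>
    stays unitriangular.\<close>
  define B where "B = mat (n + 1) (n + 1) (\<lambda>(m, j). weight m * L j m)"
  have carrier: "A \<in> carrier_mat (n + 1) (n + 1)" "B \<in> carrier_mat (n + 1) (n + 1)"
    by (simp_all add: A_def B_def)
  have entry: "L (i + j) 0 = (\<Sum>m<n + 1. L i m * (weight m * L j m))" if "i < n + 1" for i j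
  proof -
    \<comment> \<open>\<open>first_column_add\<close> needs more than \<open>i + j\<close> summands;
      those beyond \<open>n\<close> vanish because \<open>i \<le> n\<close>.\<close>
    have "L (i + j) 0 = (\<Sum>m<n + 1 + j. weight m * (L i m * L j m))"
      using that by (intro first_column_add[symmetric]) simp
    also have "\<dots> = (\<Sum>m<n + 1. weight m * (L i m * L j m))"
      using that by (intro sum.mono_neutral_right) (auto simp: eq_0)
    finally show ?thesis by (simp add: mult_ac)
  qed
  have "mat (n + 1) (n + 1) (\<lambda>(i, j). L (i + j) 0) = A * B"
    by (rule eq_matI)
      (simp_all add: A_def B_def scalar_prod_def entry lessThan_atLeast0 del: sum.op_ivl_Suc)
  then have "hankel_transform (\<lambda>m. L m 0) n = det A * det B"
    by (simp add: hankel_transform_def det_mult[OF carrier])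
  also have "det A = prod_list (diag_mat A)"
    by (rule det_lower_triangular[OF _ carrier(1)]) (simp add: A_def eq_0)
  also have "\<dots> = 1"
    by (simp add: prod_list_diag_prod A_def diagonal)
  also have "det B = prod_list (diag_mat B)"
    by (rule det_upper_triangular[OF _ carrier(2)]) (auto simp: B_def upper_triangular_def eq_0)
  also have "\<dots> = (\<Prod>m\<le>n. weight m)"
    by (simp add: prod_list_diag_prod B_def diagonal atLeast0LessThan lessThan_Suc_atMost
        del: prod.op_ivl_Suc)
  finally show ?thesis by (simp add: weight_def)
qed

end

subsection \<open>Differential equations of the generating function\<close>

lemma fps_pow_nth_0 [simp]: "fps_nth (fps_pow u y) 0 = 1"
  by (simp add: fps_pow_def)

text \<open>Logarithmic differentiation by the chain rule; multiplying by \<open>u\<close> keeps the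
  inverse out of the statement.\<close>

lemma fps_deriv_fps_pow:
  fixes u :: "'a::field_char_0 fps"
  assumes "fps_nth u 0 = 1"
  shows "u * fps_deriv (fps_pow u y) = fps_const y * fps_pow u y * fps_deriv u"
proof -
  have u: "fps_nth (u - 1) 0 = 0" using assms by simp
  have ln: "fps_nth (fps_ln 1 oo (u - 1)) 0 = 0" by simp
  have "inverse (1 + fps_X) oo (u - 1) = inverse u"
    by (subst fps_inverse_compose[OF u]) (simp_all add: fps_compose_add_distrib fps_X_fps_compose_startby0[OF u])
  then have "fps_deriv (fps_ln 1 oo (u - 1)) = inverse u * fps_deriv u"
    by (simp add: fps_compose_deriv[OF u] fps_ln_deriv)
  then have "fps_deriv (fps_pow u y) = fps_const y * fps_pow u y * (inverse u * fps_deriv u)"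
    by (simp add: fps_pow_def fps_compose_deriv[OF ln] fps_const_mult_apply_left)
  moreover have "u * inverse u = 1"
    using assms by (simp add: inverse_mult_eq_1')
  ultimately show ?thesis
    by (metis (no_types, lifting) mult.assoc mult.left_commute mult_1)
qed

lemma fps_deriv_sv_base:
  fixes x :: "'a::field_char_0"
  assumes "x \<noteq> 1"
  defines "u \<equiv> sv_base x"
  shows "fps_deriv u = u * (fps_const (1 - x) + fps_const x * u)"
proof -
  define E where "E = fps_exp (x - 1)"
  have unit: "fps_nth (E - fps_const x) 0 \<noteq> 0" using assms(1) by (simp add: E_def)
  have eq: "u * (E - fps_const x) = fps_const (1 - x)"
    using unit unfolding u_def sv_base_def E_def[symmetric]
    by (simp add: fps_divide_unit mult.assoc inverse_mult_eq_1)
  have "fps_deriv u * (E - fps_const x) + u * (fps_const (x - 1) * E) = 0"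
    using arg_cong[OF eq, of fps_deriv] by (simp add: E_def mult.commute add.commute)
  then have "fps_deriv u * (E - fps_const x) = fps_const (1 - x) * (u * E)"
    by (simp add: algebra_simps flip: fps_const_sub)
  \<comment> \<open>Reading 1 - x backwards through \<open>eq\<close> produces the factor
    \<open>E - fps_const x\<close> on both sides, ready to cancel.\<close>
  also have "\<dots> = u * (E - fps_const x) * (u * E)" by (simp only: eq)
  also have "\<dots> = u * (u * E) * (E - fps_const x)" by (simp add: mult_ac)
  finally have "fps_deriv u = u * (u * E)" using unit by auto
  also have "u * E = fps_const (1 - x) + fps_const x * u"
    unfolding eq[symmetric] by (simp add: algebra_simps)
  finally show ?thesis .
qed

text \<open>Powers of u - 1, not of u: they have constant term 0 for m > 0, so row 0 of the array is
  a unit vector.\<close>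

definition sv_gf :: "'a::field_char_0 \<Rightarrow> 'a \<Rightarrow> nat \<Rightarrow> 'a fps" where
  "sv_gf x y m = fps_pow (sv_base x) y * (sv_base x - 1) ^ m"

context
  fixes x y :: "'a::field_char_0"
  assumes x: "x \<noteq> 1"
begin

lemma fps_deriv_sv_gf:
  "fps_deriv (fps_pow (sv_base x) y) =
     fps_const y * fps_pow (sv_base x) y * (fps_const (1 - x) + fps_const x * sv_base x)"
proof -
  have "sv_base x \<noteq> 0" using sv_base_nth_0[OF x] by auto
  moreover have "sv_base x * fps_deriv (fps_pow (sv_base x) y) = sv_base x *
      (fps_const y * fps_pow (sv_base x) y * (fps_const (1 - x) + fps_const x * sv_base x))"
    by (simp add: fps_deriv_fps_pow sv_base_nth_0[OF x] fps_deriv_sv_base[OF x] mult_ac)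
  ultimately show ?thesis by simp
qed

lemma fps_deriv_sv_gf_0:
  "fps_deriv (sv_gf x y 0) = fps_const y * sv_gf x y 0 + fps_const (x * y) * sv_gf x y 1"
  by (simp add: sv_gf_def fps_deriv_sv_gf algebra_simps flip: fps_const_sub fps_const_mult)

text \<open>With g = u - 1, g' = (1 + g)(1 + x g) is quadratic in g and f' = y f (1 + x g) is f
  times a linear factor, so differentiating f g^(m+1) reaches only the neighbouring powers.\<close>

lemma fps_deriv_sv_gf_Suc:
  "fps_deriv (sv_gf x y (Suc m)) = fps_const (of_nat (Suc m)) * sv_gf x y m
     + fps_const (y + of_nat (Suc m) * (1 + x)) * sv_gf x y (Suc m)
     + fps_const (x * (y + of_nat (Suc m))) * sv_gf x y (Suc (Suc m))"
proof -
  define f where "f = fps_pow (sv_base x) y"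
  define g where "g = sv_base x - 1"
  have u: "sv_base x = 1 + g" by (simp add: g_def)
  have g': "fps_deriv g = (1 + g) * (1 + fps_const x * g)"
    using fps_deriv_sv_base[OF x] by (simp add: u algebra_simps flip: fps_const_sub)
  have f': "fps_deriv f = fps_const y * f * (1 + fps_const x * g)"
    using fps_deriv_sv_gf by (simp add: u f_def algebra_simps flip: fps_const_sub)
  have "fps_deriv (g ^ Suc m) = fps_const (of_nat (Suc m)) * fps_deriv g * g ^ m"
    by (simp add: fps_deriv_power del: power_Suc)
  then have "fps_deriv (f * g ^ Suc m) =
      fps_const (of_nat (Suc m)) * (f * g ^ m)
      + fps_const (y + of_nat (Suc m) * (1 + x)) * (f * g ^ Suc m)
      + fps_const (x * (y + of_nat (Suc m))) * (f * g ^ Suc (Suc m))"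
    by (simp add: f' g' algebra_simps fps_of_nat
        flip: fps_const_add fps_const_mult)
  then show ?thesis by (simp add: sv_gf_def f_def g_def)
qed

end

subsection \<open>The array of the \<open>1/k\<close>-Eulerian polynomials\<close>

text \<open>The factor k^n n! turns column 0 into the polynomials; dividing by k^m m! normalises to
  1 the coefficient of the preceding column in the recurrence.\<close>

definition eulerian_array :: "'a::field_char_0 \<Rightarrow> 'a \<Rightarrow> nat \<Rightarrow> nat \<Rightarrow> 'a" where
  "eulerian_array x k n m = k ^ n * fact n * fps_nth (sv_gf x (1 / k) m) n / (k ^ m * fact m)"

lemma eulerian_array_0: "eulerian_array x k n 0 = inv_eulerian n k x"
  by (simp add: eulerian_array_def inv_eulerian_def sv_poly_def sv_gf_def)

lemma eulerian_array_stieltjes: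
  fixes x k :: "'a::field_char_0"
  assumes x: "x \<noteq> 1" and k: "k \<noteq> 0"
  shows "stieltjes_array (eulerian_array x k)
    (\<lambda>m. 1 + of_nat m * k * (1 + x)) (\<lambda>m. k * x * (of_nat (Suc m) * (of_nat m * k + 1)))"
proof
  \<comment> \<open>Passing to the next row is differentiation of the series.\<close>
  have fact: "fact (Suc n) * fps_nth F (Suc n) = fact n * fps_nth (fps_deriv F) n"
    for F :: "'a fps" and n
    by (simp add: algebra_simps)
  show "eulerian_array x k 0 m = (if m = 0 then 1 else 0)" for m
    by (simp add: eulerian_array_def sv_gf_def sv_base_nth_0[OF x] power_0_left)
  fix n
  show "eulerian_array x k (Suc n) 0 = (1 + of_nat 0 * k * (1 + x)) * eulerian_array x k n 0
      + k * x * (of_nat (Suc 0) * (of_nat 0 * k + 1)) * eulerian_array x k n 1"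
    unfolding eulerian_array_def mult.assoc[of _ "fact (Suc n)"] fact fps_deriv_sv_gf_0[OF x]
    using k by (simp add: field_simps)
  fix m
  have nz: "fact m \<noteq> (0::'a)" "of_nat (Suc m) \<noteq> (0::'a)" "of_nat (Suc (Suc m)) \<noteq> (0::'a)"
    by (simp_all del: of_nat_Suc)
  show "eulerian_array x k (Suc n) (Suc m) = eulerian_array x k n m
      + (1 + of_nat (Suc m) * k * (1 + x)) * eulerian_array x k n (Suc m)
      + k * x * (of_nat (Suc (Suc m)) * (of_nat (Suc m) * k + 1)) * eulerian_array x k n (Suc (Suc m))"
    unfolding eulerian_array_def mult.assoc[of _ "fact (Suc n)"] fact fps_deriv_sv_gf_Suc[OF x]
    using k nz by (simp add: field_simps del: of_nat_Suc)
qed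

text \<open>The factor \<open>of_nat i * k + 1\<close> occurs once for each m with i < m \<le> n,
  hence n - i times, and is 1 for i = 0. The other factors give m! and (k x)^m for each m.\<close>

lemma prod_eulerian_weights:
  fixes x k :: "'a::{comm_ring_1,semiring_char_0}"
  shows "(\<Prod>m\<le>n. \<Prod>i<m. k * x * (of_nat (Suc i) * (of_nat i * k + 1))) =
    (k * x) ^ (Suc n choose 2) * (\<Prod>j=0..n. fact j) * (\<Prod>i=1..n. (of_nat i * k + 1) ^ (n - i))"
proof (induction n)
  case 0
  then show ?case by (simp add: numeral_2_eq_2)
next
  case (Suc n)
  have fact: "(\<Prod>i<m. of_nat (Suc i)) = (fact m :: 'a)" for m
    by (induction m) (simp_all add: algebra_simps)
  have shift: "(\<Prod>i<Suc n. of_nat i * k + 1) = (\<Prod>i=1..n. of_nat i * k + 1)"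
    by (simp add: prod.lessThan_Suc_shift prod.atLeast1_atMost_eq del: prod.lessThan_Suc)
  have row: "(\<Prod>i<Suc n. k * x * (of_nat (Suc i) * (of_nat i * k + 1))) =
      (k * x) ^ Suc n * fact (Suc n) * (\<Prod>i=1..n. of_nat i * k + 1)"
    unfolding prod.distrib fact shift prod_constant card_lessThan power_mult_distrib
    by (simp only: mult_ac)
  have "(\<Prod>i=1..Suc n. (of_nat i * k + 1) ^ (Suc n - i)) = (\<Prod>i=1..n. (of_nat i * k + 1) ^ (Suc n - i))"
    by simp
  also have "\<dots> = (\<Prod>i=1..n. (of_nat i * k + 1) ^ (n - i) * (of_nat i * k + 1))"
    by (intro prod.cong) (simp_all add: Suc_diff_le)
  finally have power: "(\<Prod>i=1..Suc n. (of_nat i * k + 1) ^ (Suc n - i)) =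
      (\<Prod>i=1..n. (of_nat i * k + 1) ^ (n - i)) * (\<Prod>i=1..n. of_nat i * k + 1)"
    by (simp only: prod.distrib)
  have choose: "Suc (Suc n) choose 2 = (Suc n choose 2) + Suc n"
    by (simp add: numeral_2_eq_2)
  have "(\<Prod>j=0..Suc n. fact j :: 'a) = (\<Prod>j=0..n. fact j) * fact (Suc n)"
    by (rule prod.atLeast0_atMost_Suc)
  then show ?case
    unfolding prod.atMost_Suc Suc.IH row power choose power_add by (simp only: mult_ac)
qed

theorem corollary4:
  fixes n :: nat and x k :: "rat poly poly fract"
  defines "x \<equiv> indet_x" and "k \<equiv> indet_k"
  shows "hankel_transform (\<lambda>m. inv_eulerian m k x) n
           = (k * x) ^ (Suc n choose 2) * (\<Prod>j=0..n. fact j) * (\<Prod>i=1..n. (of_nat i * k + 1) ^ (n - i))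
       \<and> hankel_transform (\<lambda>m. inv_eulerian m k x) n
           = (k * x) ^ (Suc n choose 2) * (\<Prod>i=1..n. fact i * (of_nat i * k + 1) ^ (n - i))"
proof -
  interpret stieltjes_array "eulerian_array x k" "\<lambda>m. 1 + of_nat m * k * (1 + x)"
    "\<lambda>m. k * x * (of_nat (Suc m) * (of_nat m * k + 1))"
    unfolding x_def k_def by (intro eulerian_array_stieltjes indet_x_neq_1 indet_k_neq_0)
  have hankel: "hankel_transform (\<lambda>m. inv_eulerian m k x) n
      = (k * x) ^ (Suc n choose 2) * (\<Prod>j=0..n. fact j) * (\<Prod>i=1..n. (of_nat i * k + 1) ^ (n - i))"
    using hankel_transform_first_column[of n] by (simp only: eulerian_array_0 prod_eulerian_weights)
  moreover have "(\<Prod>j=0..n. fact j) = (\<Prod>j=1..n. fact j :: rat poly poly fract)"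
    by (simp add: prod.atLeast_Suc_atMost[of 0])
  ultimately show ?thesis by (simp add: prod.distrib mult.assoc)
qed

end
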